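(* Let $X$ and $Y$ be Banach spaces, let $1\le p<\infty$, and let $Z=X\oplus_p Y$. Then $Z$ has the Ball Huskable Property ($BHP$) if and only if $X$ or $Y$ has $BHP$.
   Context: Banach spaces $X,Y$ are real and nontrivial; $B_X$ is the closed unit ball of $X$. $X\oplus_p Y$ is $X\times Y$ with norm $\|(x,y)\|=(\|x\|^p+\|y\|^p)^{1/p}$. $X$ has $BHP$ if $B_X$ has nonempty relatively weakly open subsets of arbitrarily small diameter (for every $\varepsilon>0$ there is a nonempty relatively weakly open subset of $B_X$ of diameter less than $\varepsilon$). *)

theory Defs
  imports "HOL-Analysis.Analysis"
begin

text \<open>
  The exponent of a p-direct sum is a term, so its norm cannot be the type-class norm of the
  product type (which is the case of exponent 2). All notions below therefore take the norm of
  the space as an explicit argument \<open>N\<close>; for a type of class \<open>banach\<close>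
  one takes \<open>N = norm\<close>.
\<close>

definition psum_norm :: "real \<Rightarrow> 'a::real_normed_vector \<times> 'b::real_normed_vector \<Rightarrow> real" where
  "psum_norm p z = (norm (fst z) powr p + norm (snd z) powr p) powr (1 / p)"

definition norm_unit_ball :: "('a::real_vector \<Rightarrow> real) \<Rightarrow> 'a set" where
  "norm_unit_ball N = {x. N x \<le> 1}"

definition norm_dual :: "('a::real_vector \<Rightarrow> real) \<Rightarrow> ('a \<Rightarrow> real) set" where
  "norm_dual N = {f. linear f \<and> (\<exists>K. \<forall>x. \<bar>f x\<bar> \<le> K * N x)}"

definition norm_weak_topology :: "('a::real_vector \<Rightarrow> real) \<Rightarrow> 'a topology" where
  "norm_weak_topology N = topology_generated_by {f -` U | f U. f \<in> norm_dual N \<and> open U}"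

definition norm_diameter :: "('a::real_vector \<Rightarrow> real) \<Rightarrow> 'a set \<Rightarrow> real" where
  "norm_diameter N S = (if S = {} then 0 else SUP (x, y)\<in>S \<times> S. N (x - y))"

definition BHP :: "('a::real_vector \<Rightarrow> real) \<Rightarrow> bool" where
  "BHP N \<longleftrightarrow> (\<forall>\<epsilon>>0. \<exists>W. openin (subtopology (norm_weak_topology N) (norm_unit_ball N)) W
     \<and> W \<noteq> {} \<and> norm_diameter N W < \<epsilon>)"

lemma psum_norm_2: "psum_norm 2 z = norm z"
  by (simp add: psum_norm_def norm_prod_def powr_half_sqrt)

lemma norm_unit_ball_norm: "norm_unit_ball norm = cball 0 1"
  by (auto simp: norm_unit_ball_def)

lemma norm_dual_norm: "norm_dual norm = {f. bounded_linear f}"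
  by (auto simp: norm_dual_def bounded_linear_def bounded_linear_axioms_def mult.commute)

lemma topspace_norm_weak_topology: "topspace (norm_weak_topology N) = UNIV"
proof -
  have "(\<lambda>x. 0) \<in> norm_dual N"
    by (auto simp: norm_dual_def linear_zero intro: exI[of _ 0])
  then have "UNIV \<in> {f -` U | f U. f \<in> norm_dual N \<and> open U}"
    by (intro CollectI exI[of _ "\<lambda>x. 0"] exI[of _ UNIV]) auto
  then show ?thesis
    unfolding norm_weak_topology_def topology_generated_by_topspace by blast
qed

lemma norm_diameter_norm: "norm_diameter norm S = diameter S"
  by (simp add: norm_diameter_def diameter_def dist_norm)

end

theory Submission
  imports Defs
begin

text \<open>
  A nonempty relatively weakly open subset of a unit ball contains a patch: the points \<open>x\<close> of
  the ball with \<open>\<bar>f x - f x\<^sub>0\<bar> < d\<close> for finitely many functionals \<open>f\<close> and a centre \<open>x\<^sub>0\<close> in the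
  ball. So BHP says that there are patches of arbitrarily small diameter
  (\<open>BHP_iff_small_patch\<close>), and the theorem is a matter of moving patches between \<open>X\<close> and
  \<open>X \<oplus>\<^sub>p Y\<close>.

  From \<open>X\<close> to the sum, the cylinder over a small patch of \<open>X\<close> need not be small, because the second
  coordinate may be large where the first is not close to norm 1. However, a small patch can
  always be taken with a centre of norm almost 1 (\<open>small_patch_near_sphere\<close>): if the centre
  stays away from the sphere, then the functionals of the patch already control the norm on the
  whole space, and the patch can be translated to any point of the sphere. All points of such a
  patch have norm almost 1, since its diameter is small, so they leave
  little room for the second coordinate (\<open>BHP_first_imp_BHP_psum\<close>).

  From the sum to \<open>X\<close> or \<open>Y\<close>, freeze the coordinate of the centre that has the smaller norm. In the
  other coordinate the patch then contains a patch of a ball of radius at least \<open>1/2\<close>, which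
  rescales to a patch of the unit ball of at most twice the diameter
  (\<open>small_patch_of_sum_imp_first\<close>).
\<close>

section \<open>Patches and the weak topology\<close>

text \<open>
  The functionals in \<open>F\<close> share the tolerance \<open>d\<close>; as \<open>F\<close> is finite this is as general as one
  tolerance for each functional.
\<close>

definition patch :: "('a::real_vector \<Rightarrow> real) \<Rightarrow> 'a \<Rightarrow> ('a \<Rightarrow> real) set \<Rightarrow> real \<Rightarrow> 'a set" where
  "patch N x0 F d = {x. N x \<le> 1 \<and> (\<forall>f\<in>F. \<bar>f x - f x0\<bar> < d)}"

definition small_patch ::
  "('a::real_vector \<Rightarrow> real) \<Rightarrow> real \<Rightarrow> 'a \<Rightarrow> ('a \<Rightarrow> real) set \<Rightarrow> real \<Rightarrow> bool" where
  "small_patch N e x0 F d \<longleftrightarrow> finite F \<and> F \<subseteq> norm_dual N \<and> 0 < d \<and> N x0 \<le> 1 \<and>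
     (\<forall>x\<in>patch N x0 F d. \<forall>y\<in>patch N x0 F d. N (x - y) \<le> e)"

lemma openin_weak_imp_functional_nbhd:
  assumes "openin (norm_weak_topology N) T" "x0 \<in> T"
  shows "\<exists>F d. finite F \<and> F \<subseteq> norm_dual N \<and> 0 < d \<and> {x. \<forall>f\<in>F. \<bar>f x - f x0\<bar> < d} \<subseteq> T"
proof -
  have "generate_topology_on {f -` U | f U. f \<in> norm_dual N \<and> open U} T"
    using assms(1) by (simp add: norm_weak_topology_def openin_topology_generated_by_iff)
  then show ?thesis
    using assms(2)
  proof (induction rule: generate_topology_on.induct)
    case Empty
    then show ?case by simp
  next
    case (Int a b)
    obtain F d where F: "finite F" "F \<subseteq> norm_dual N" "0 < d" "{x. \<forall>f\<in>F. \<bar>f x - f x0\<bar> < d} \<subseteq> a"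
      using Int by blast
    obtain G c where G: "finite G" "G \<subseteq> norm_dual N" "0 < c" "{x. \<forall>f\<in>G. \<bar>f x - f x0\<bar> < c} \<subseteq> b"
      using Int by blast
    have "{x. \<forall>f\<in>F \<union> G. \<bar>f x - f x0\<bar> < min c d} \<subseteq> a \<inter> b"
      using F(4) G(4) by auto
    then show ?case
      using F(1-3) G(1-3) by (intro exI[of _ "F \<union> G"] exI[of _ "min c d"]) auto
  next
    case (UN K)
    then obtain k where k: "k \<in> K" "x0 \<in> k" by blast
    show ?case
      using UN.IH[OF k] k(1) by (meson Sup_upper order_trans)
  next
    case (Basis s)
    then obtain f U where s: "s = f -` U" "f \<in> norm_dual N" "open U" by blast
    then obtain d where "0 < d" "\<And>t. \<bar>t - f x0\<bar> < d \<Longrightarrow> t \<in> U"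
      using Basis.prems by (auto simp: open_dist dist_real_def)
    then show ?case
      using s by (intro exI[of _ "{f}"] exI[of _ d]) auto
  qed
qed

lemma openin_weak_functional_nbhd:
  assumes "finite F" "F \<subseteq> norm_dual N"
  shows "openin (norm_weak_topology N) {x. \<forall>f\<in>F. \<bar>f x - f x0\<bar> < d}"
  using assms
proof (induction F rule: finite_induct)
  case empty
  then show ?case
    using openin_topspace[of "norm_weak_topology N"] by (simp add: topspace_norm_weak_topology)
next
  case (insert f F)
  have "openin (norm_weak_topology N) (f -` ball (f x0) d)"
    unfolding norm_weak_topology_def
    by (rule topology_generated_by_Basis) (use insert.prems in auto)
  moreover have "{x. \<forall>g\<in>insert f F. \<bar>g x - g x0\<bar> < d}
      = f -` ball (f x0) d \<inter> {x. \<forall>g\<in>F. \<bar>g x - g x0\<bar> < d}"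
    by (auto simp: dist_real_def abs_minus_commute)
  ultimately show ?case
    using insert by (simp add: openin_Int)
qed

text \<open>
  Boundedness of \<open>N\<close> on differences of points of the ball keeps the supremum in
  \<^const>\<open>norm_diameter\<close> from being an unspecified value. It follows from the triangle inequality,
  and also from a comparison with a norm, which is how the p-sum gets it.
\<close>

lemma BHP_iff_small_patch:
  assumes bounded: "\<And>x y. N x \<le> 1 \<Longrightarrow> N y \<le> 1 \<Longrightarrow> N (x - y) \<le> K"
  shows "BHP N \<longleftrightarrow> (\<forall>e>0. \<exists>x0 F d. small_patch N e x0 F d)"
proof
  assume N: "BHP N"
  show "\<forall>e>0. \<exists>x0 F d. small_patch N e x0 F d"
  proof (intro allI impI)
    fix e :: real assume "0 < e"
    with N obtain W where W: "openin (subtopology (norm_weak_topology N) (norm_unit_ball N)) W"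
      "W \<noteq> {}" "norm_diameter N W < e"
      unfolding BHP_def by blast
    obtain T where T: "openin (norm_weak_topology N) T" "W = T \<inter> norm_unit_ball N"
      using W(1) by (auto simp: openin_subtopology)
    obtain x0 where x0: "x0 \<in> W" using W(2) by blast
    then have "x0 \<in> T" using T(2) by simp
    then obtain F d where F: "finite F" "F \<subseteq> norm_dual N" "0 < d" "{x. \<forall>f\<in>F. \<bar>f x - f x0\<bar> < d} \<subseteq> T"
      using openin_weak_imp_functional_nbhd[OF T(1)] by meson
    have "N (x - y) \<le> e" if "x \<in> W" "y \<in> W" for x y
    proof -
      have "bdd_above ((\<lambda>(x, y). N (x - y)) ` (W \<times> W))"
        using T(2) bounded by (intro bdd_aboveI[of _ K]) (auto simp: norm_unit_ball_def)
      then have "N (x - y) \<le> (SUP (x, y)\<in>W \<times> W. N (x - y))"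
        using that cSUP_upper[of "(x, y)" "W \<times> W" "\<lambda>(x, y). N (x - y)"] by simp
      then show ?thesis using W(2,3) by (simp add: norm_diameter_def)
    qed
    moreover have "patch N x0 F d \<subseteq> W"
      using F(4) T(2) by (auto simp: patch_def norm_unit_ball_def)
    moreover have "N x0 \<le> 1" using x0 T(2) by (simp add: norm_unit_ball_def)
    ultimately have "small_patch N e x0 F d"
      using F(1-3) unfolding small_patch_def by blast
    then show "\<exists>x0 F d. small_patch N e x0 F d" by blast
  qed
next
  assume *: "\<forall>e>0. \<exists>x0 F d. small_patch N e x0 F d"
  show "BHP N"
    unfolding BHP_def
  proof (intro allI impI)
    fix e :: real assume "0 < e"
    with * obtain x0 F d where p: "small_patch N (e/2) x0 F d"
      by (meson half_gt_zero)
    let ?W = "patch N x0 F d"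
    have W: "?W = {x. \<forall>f\<in>F. \<bar>f x - f x0\<bar> < d} \<inter> norm_unit_ball N"
      by (auto simp: patch_def norm_unit_ball_def)
    have "openin (norm_weak_topology N) {x. \<forall>f\<in>F. \<bar>f x - f x0\<bar> < d}"
      using p by (intro openin_weak_functional_nbhd) (auto simp: small_patch_def)
    then have 1: "openin (subtopology (norm_weak_topology N) (norm_unit_ball N)) ?W"
      unfolding W openin_subtopology by blast
    have 2: "x0 \<in> ?W" using p by (simp add: small_patch_def patch_def)
    have "(SUP (x, y)\<in>?W \<times> ?W. N (x - y)) \<le> e/2"
      using 2 p by (intro cSUP_least) (auto simp: small_patch_def)
    then have "norm_diameter N ?W < e"
      using 2 \<open>0 < e\<close> by (auto simp: norm_diameter_def)
    then show "\<exists>W. openin (subtopology (norm_weak_topology N) (norm_unit_ball N)) W \<and> W \<noteq> {}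
        \<and> norm_diameter N W < e"
      using 1 2 by blast
  qed
qed

lemma BHP_norm_iff:
  "BHP (norm :: 'a::real_normed_vector \<Rightarrow> real)
     \<longleftrightarrow> (\<forall>e>0. \<exists>(x0::'a) F d. small_patch norm e x0 F d)"
  by (rule BHP_iff_small_patch[where K = 2]) (rule norm_triangle_le_diff, simp)

lemma small_patch_mono: "small_patch N e x0 F d \<Longrightarrow> e \<le> e' \<Longrightarrow> small_patch N e' x0 F d"
  unfolding small_patch_def by fastforce

text \<open>
  Suppose \<open>\<parallel>x\<^sub>0\<parallel> < 1 - e\<close>, and let \<open>U\<close> be the set of \<open>u\<close> with \<open>\<bar>f u\<bar> < d\<close> for all
  \<open>f\<close> in \<open>F\<close>, which is star-shaped about 0. If some \<open>u\<close> in \<open>U\<close> were longer than \<open>e\<close>, then it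
  could be shortened until \<open>e < \<parallel>u\<parallel> \<le> 1 - \<parallel>x\<^sub>0\<parallel>\<close>, and \<open>x\<^sub>0 + u\<close> would be
  a point of the patch too far from \<open>x\<^sub>0\<close>. Hence \<open>U\<close> has radius at most \<open>e\<close>, and its
  translate to any point of the sphere gives the patch.
\<close>

lemma small_patch_near_sphere:
  fixes x0 :: "'a::real_normed_vector"
  assumes nontrivial: "\<exists>x::'a. x \<noteq> 0" and p: "small_patch norm e x0 F d" and "0 < e"
  shows "\<exists>x1 :: 'a. 1 - e \<le> norm x1 \<and> small_patch norm (2 * e) x1 F d"
proof (cases "1 - e \<le> norm x0")
  case True
  then show ?thesis using small_patch_mono[OF p] \<open>0 < e\<close> by force
next
  case False
  define c where "c = 1 - norm x0"
  have c: "e < c" using False by (simp add: c_def)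
  have lin: "linear f" if "f \<in> F" for f
    using p that by (auto simp: small_patch_def norm_dual_def)
  have short: "norm u \<le> e" if u: "\<forall>f\<in>F. \<bar>f u\<bar> < d" and uc: "norm u \<le> c" for u
  proof -
    have "norm (x0 + u) \<le> 1"
      using uc norm_triangle_ineq[of x0 u] by (simp add: c_def)
    then have "x0 + u \<in> patch norm x0 F d"
      using u lin by (auto simp: patch_def linear_add)
    moreover have "x0 \<in> patch norm x0 F d"
      using p by (simp add: small_patch_def patch_def)
    ultimately have "norm ((x0 + u) - x0) \<le> e"
      using p unfolding small_patch_def by blast
    then show ?thesis by simp
  qed
  have all_short: "norm u \<le> e" if u: "\<forall>f\<in>F. \<bar>f u\<bar> < d" for u
  proof (rule ccontr)
    assume "\<not> norm u \<le> e"
    then have long: "c < norm u" using short[OF u] by force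
    define t where "t = c / norm u"
    have t: "0 < t" "t < 1" "norm (t *\<^sub>R u) = c"
      using long c \<open>0 < e\<close> less_trans[of 0 c "norm u"] by (auto simp: t_def)
    have "\<bar>f (t *\<^sub>R u)\<bar> < d" if "f \<in> F" for f
    proof -
      have "\<bar>f (t *\<^sub>R u)\<bar> = t * \<bar>f u\<bar>"
        using lin[OF that] t by (simp add: linear_scale abs_mult)
      also have "\<dots> \<le> \<bar>f u\<bar>" using t by (simp add: mult_left_le_one_le)
      finally show ?thesis using u that by fastforce
    qed
    then have "c \<le> e" using short[of "t *\<^sub>R u"] t by simp
    then show False using c by simp
  qed
  obtain v :: 'a where "v \<noteq> 0" using nontrivial by blast
  define x1 where "x1 = v /\<^sub>R norm v"
  have x1: "norm x1 = 1" using \<open>v \<noteq> 0\<close> by (simp add: x1_def)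
  have near: "norm (x - x1) \<le> e" if "x \<in> patch norm x1 F d" for x
    using that lin by (intro all_short) (auto simp: patch_def linear_diff)
  have "norm (x - y) \<le> 2 * e" if "x \<in> patch norm x1 F d" "y \<in> patch norm x1 F d" for x y
    using near[OF that(1)] near[OF that(2)] norm_triangle_ineq4[of "x - x1" "y - x1"] by simp
  then have "small_patch norm (2 * e) x1 F d"
    using p x1 by (simp add: small_patch_def)
  then show ?thesis using x1 \<open>0 < e\<close> by (intro exI[of _ x1]) auto
qed

section \<open>The norm of a p-direct sum\<close>

lemma powr_le_powr_base_iff:
  fixes a b p :: real
  assumes "0 < p" "0 \<le> a" "0 \<le> b"
  shows "a powr p \<le> b powr p \<longleftrightarrow> a \<le> b"
  using assms powr_mono2[of p a b] powr_less_mono2[of p b a] by (auto simp: not_le[symmetric])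

lemma psum_norm_le_iff:
  assumes "1 \<le> p" "0 \<le> r"
  shows "psum_norm p z \<le> r \<longleftrightarrow> norm (fst z) powr p + norm (snd z) powr p \<le> r powr p"
proof -
  define s where "s = norm (fst z) powr p + norm (snd z) powr p"
  have "r = (r powr p) powr (1 / p)" using assms by (simp add: powr_powr)
  then have "psum_norm p z \<le> r \<longleftrightarrow> s powr (1 / p) \<le> (r powr p) powr (1 / p)"
    by (simp add: psum_norm_def s_def)
  also have "\<dots> \<longleftrightarrow> s \<le> r powr p"
    using assms by (intro powr_le_powr_base_iff) (auto simp: s_def)
  finally show ?thesis by (simp add: s_def)
qed

lemma psum_norm_le_one_iff:
  "1 \<le> p \<Longrightarrow> psum_norm p z \<le> 1 \<longleftrightarrow> norm (fst z) powr p + norm (snd z) powr p \<le> 1"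
  using psum_norm_le_iff[of p 1 z] by simp

lemma psum_norm_nonneg: "0 \<le> psum_norm p z"
  by (simp add: psum_norm_def)

lemma psum_norm_first: "1 \<le> p \<Longrightarrow> psum_norm p (x, 0) = norm x"
  by (simp add: psum_norm_def powr_powr)

lemma psum_norm_swap: "psum_norm p (prod.swap z) = psum_norm p z"
  by (simp add: psum_norm_def add.commute)

lemma norm_fst_le_psum_norm:
  assumes "1 \<le> p" shows "norm (fst z) \<le> psum_norm p z"
proof -
  have "norm (fst z) powr p \<le> psum_norm p z powr p"
    using psum_norm_le_iff[OF assms psum_norm_nonneg, of z p z]
      powr_ge_zero[of "norm (snd z)" p] by linarith
  then show ?thesis
    using assms psum_norm_nonneg[of p z] by (subst (asm) powr_le_powr_base_iff) auto
qed

lemma norm_snd_le_psum_norm: "1 \<le> p \<Longrightarrow> norm (snd z) \<le> psum_norm p z"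
  using norm_fst_le_psum_norm[of p "prod.swap z"] by (simp add: psum_norm_swap)

lemma psum_norm_le_twice:
  assumes "1 \<le> p" "norm (fst z) \<le> r" "norm (snd z) \<le> r"
  shows "psum_norm p z \<le> 2 * r"
proof -
  have r: "0 \<le> r" using assms(2) norm_ge_zero order_trans by blast
  have "norm (fst z) powr p + norm (snd z) powr p \<le> 2 * r powr p"
    using powr_mono2[of p "norm (fst z)" r] powr_mono2[of p "norm (snd z)" r] assms by simp
  also have "\<dots> \<le> 2 powr p * r powr p"
    using powr_mono[of 1 p "2::real"] assms by (intro mult_right_mono) auto
  also have "\<dots> = (2 * r) powr p" using r by (simp add: powr_mult)
  finally show ?thesis using assms r by (simp add: psum_norm_le_iff)
qed

lemma BHP_psum_norm_iff:
  assumes "1 \<le> p"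
  shows "BHP (psum_norm p :: 'a::real_normed_vector \<times> 'b::real_normed_vector \<Rightarrow> real)
     \<longleftrightarrow> (\<forall>e>0. \<exists>(z::'a \<times> 'b) F d. small_patch (psum_norm p) e z F d)"
proof (rule BHP_iff_small_patch[where K = 4])
  fix z w :: "'a \<times> 'b"
  assume "psum_norm p z \<le> 1" "psum_norm p w \<le> 1"
  then have "norm (fst z) \<le> 1" "norm (fst w) \<le> 1" "norm (snd z) \<le> 1" "norm (snd w) \<le> 1"
    using norm_fst_le_psum_norm[OF assms] norm_snd_le_psum_norm[OF assms] order_trans by blast+
  then have "norm (fst (z - w)) \<le> 2" "norm (snd (z - w)) \<le> 2"
    using norm_triangle_ineq4[of "fst z" "fst w"] norm_triangle_ineq4[of "snd z" "snd w"] by simp_all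
  then show "psum_norm p (z - w) \<le> 4"
    using psum_norm_le_twice[OF assms, of "z - w" 2] by simp
qed

text \<open>The coordinates play symmetric roles, so that each direction needs only one of them.\<close>

lemma small_patch_psum_swap:
  assumes "small_patch (psum_norm p) e z F d"
  shows "small_patch (psum_norm p) e (prod.swap z) ((\<lambda>f. f \<circ> prod.swap) ` F) d"
proof -
  have lin: "linear (prod.swap :: 'x::real_normed_vector \<times> 'y::real_normed_vector \<Rightarrow> 'y \<times> 'x)"
    by (rule linearI) auto
  have dual: "f \<circ> prod.swap \<in> norm_dual (psum_norm p)" if "f \<in> F" for f
  proof -
    have "f \<in> norm_dual (psum_norm p)" using assms that by (auto simp: small_patch_def)
    then obtain K where "linear f" "\<forall>x. \<bar>f x\<bar> \<le> K * psum_norm p x"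
      by (auto simp: norm_dual_def)
    then have "\<bar>f (prod.swap x)\<bar> \<le> K * psum_norm p x" for x
      by (metis psum_norm_swap)
    then show ?thesis
      using linear_compose[OF lin \<open>linear f\<close>] unfolding norm_dual_def comp_def by blast
  qed
  have mem: "prod.swap x \<in> patch (psum_norm p) z F d"
    if "x \<in> patch (psum_norm p) (prod.swap z) ((\<lambda>f. f \<circ> prod.swap) ` F) d" for x
    using that by (auto simp: patch_def psum_norm_swap)
  have "psum_norm p (x - y) = psum_norm p (prod.swap x - prod.swap y)" for x y :: "'b \<times> 'a"
    by (metis lin linear_diff psum_norm_swap)
  then show ?thesis
    using assms dual mem unfolding small_patch_def by (auto simp: psum_norm_swap)
qed

lemma BHP_psum_swap:
  assumes "1 \<le> p" "BHP (psum_norm p :: 'a::real_normed_vector \<times> 'b::real_normed_vector \<Rightarrow> real)"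
  shows "BHP (psum_norm p :: 'b \<times> 'a \<Rightarrow> real)"
  using assms(2) small_patch_psum_swap unfolding BHP_psum_norm_iff[OF assms(1)] by blast

section \<open>From a summand to the sum\<close>

text \<open>
  The cylinder over a small patch near the sphere is small: its first coordinates have norm at least
  \<open>1 - 3h\<close>, which bounds the norm of the second coordinate by
  \<open>(1 - (1 - 3h)\<^sup>p)\<^sup>1\<^sup>/\<^sup>p\<close>.
\<close>

lemma BHP_first_imp_BHP_psum:
  assumes nontrivial: "\<exists>x::'a::real_normed_vector. x \<noteq> 0" and p: "1 \<le> p"
    and X: "BHP (norm :: 'a \<Rightarrow> real)"
  shows "BHP (psum_norm p :: 'a \<times> 'b::real_normed_vector \<Rightarrow> real)"
  unfolding BHP_psum_norm_iff[OF p]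
proof (intro allI impI)
  fix e :: real assume e: "0 < e"
  have "((\<lambda>h. 1 - (1 - 3 * h) powr p) \<longlongrightarrow> 1 - (1 - 3 * 0) powr p) (at_right 0)"
    by (intro tendsto_intros) auto
  then have "eventually (\<lambda>h. 1 - (1 - 3 * h) powr p < (e/4) powr p) (at_right 0)"
    by (rule order_tendstoD) (use e in simp)
  moreover have "eventually (\<lambda>h::real. h < min (1/3) (e/4)) (at_right 0)"
    using e by (intro order_tendstoD(2)[OF tendsto_ident_at]) auto
  moreover have "eventually (\<lambda>h::real. 0 < h) (at_right 0)"
    by (rule eventually_at_right_less)
  ultimately have "eventually (\<lambda>h. 1 - (1 - 3 * h) powr p < (e/4) powr p
      \<and> h < min (1/3) (e/4) \<and> 0 < h) (at_right 0)"
    by eventually_elim auto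
  then obtain h where h: "1 - (1 - 3 * h) powr p < (e/4) powr p" "h < min (1/3) (e/4)" "0 < h"
    using eventually_happens' by (metis (no_types, lifting) trivial_limit_at_right_real)
  obtain x0 :: 'a and F d where "small_patch norm h x0 F d"
    using X h(3) unfolding BHP_norm_iff by blast
  then obtain x1 where x1: "1 - h \<le> norm x1" and P: "small_patch norm (2 * h) x1 F d"
    using small_patch_near_sphere[OF nontrivial _ h(3)] by blast
  define G :: "('a \<times> 'b \<Rightarrow> real) set" where "G = (\<lambda>f. f \<circ> fst) ` F"
  have G: "G \<subseteq> norm_dual (psum_norm p)"
  proof -
    have "f \<circ> fst \<in> norm_dual (psum_norm p :: 'a \<times> 'b \<Rightarrow> real)" if f: "f \<in> F" for f
    proof -
      obtain K where lin: "linear f" and K: "\<And>x. \<bar>f x\<bar> \<le> K * norm x"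
        using P f unfolding small_patch_def norm_dual_def by blast
      have "\<bar>f (fst z)\<bar> \<le> \<bar>K\<bar> * psum_norm p z" for z :: "'a \<times> 'b"
      proof -
        have "\<bar>f (fst z)\<bar> \<le> \<bar>K\<bar> * norm (fst z)"
          using K[of "fst z"] by (rule order_trans) (simp add: mult_right_mono)
        also have "\<dots> \<le> \<bar>K\<bar> * psum_norm p z"
          by (intro mult_left_mono norm_fst_le_psum_norm p) simp
        finally show ?thesis .
      qed
      then show ?thesis
        using linear_compose[OF linear_fst lin] unfolding norm_dual_def comp_def by blast
    qed
    then show ?thesis by (auto simp: G_def)
  qed
  have base: "fst z \<in> patch norm x1 F d" if "z \<in> patch (psum_norm p) (x1, 0) G d" for z
    using that norm_fst_le_psum_norm[OF p, of z] by (auto simp: patch_def G_def)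
  have fibre: "norm (snd z) \<le> e/4" if z: "z \<in> patch (psum_norm p) (x1, 0) G d" for z
  proof -
    have "x1 \<in> patch norm x1 F d" using P by (simp add: small_patch_def patch_def)
    then have "norm (x1 - fst z) \<le> 2 * h"
      using P base[OF z] unfolding small_patch_def by blast
    then have "1 - 3 * h \<le> norm (fst z)"
      using x1 norm_triangle_ineq2[of x1 "fst z"] by linarith
    then have "(1 - 3 * h) powr p \<le> norm (fst z) powr p"
      using h p by (intro powr_mono2) auto
    moreover have "norm (fst z) powr p + norm (snd z) powr p \<le> 1"
      using z by (simp add: patch_def psum_norm_le_one_iff[OF p])
    ultimately have "norm (snd z) powr p \<le> (e/4) powr p" using h(1) by linarith
    then show ?thesis using p e by (subst (asm) powr_le_powr_base_iff) auto
  qed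
  have "psum_norm p (z - w) \<le> e"
    if "z \<in> patch (psum_norm p) (x1, 0) G d" "w \<in> patch (psum_norm p) (x1, 0) G d" for z w
  proof -
    have "norm (fst z - fst w) \<le> 2 * h"
      using P base[OF that(1)] base[OF that(2)] unfolding small_patch_def by blast
    then have "norm (fst (z - w)) \<le> e/2" using h by simp
    moreover have "norm (snd (z - w)) \<le> e/2"
      using fibre[OF that(1)] fibre[OF that(2)] norm_triangle_ineq4[of "snd z" "snd w"] e by simp
    ultimately show ?thesis
      using psum_norm_le_twice[OF p, of "z - w" "e/2"] by simp
  qed
  then have "small_patch (psum_norm p) e (x1, 0 :: 'b) G d"
    using P G by (simp add: small_patch_def psum_norm_first[OF p]) (simp add: G_def)
  then show "\<exists>(z::'a \<times> 'b) F d. small_patch (psum_norm p) e z F d" by blast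
qed

section \<open>From the sum to a summand\<close>

text \<open>
  With the second coordinate frozen at \<open>y\<^sub>0\<close>, the first may vary in the ball of radius
  \<open>r = max \<parallel>x\<^sub>0\<parallel> (1/2)\<close>. The lower bound \<open>1/2\<close> serves centres near the
  origin; it is admissible there because \<open>\<parallel>y\<^sub>0\<parallel> \<le> \<parallel>x\<^sub>0\<parallel> \<le> 1/2\<close> and
  \<open>(1/2)\<^sup>p + (1/2)\<^sup>p \<le> 1\<close>.
\<close>

lemma small_patch_of_sum_imp_first:
  fixes x0 :: "'a::real_normed_vector" and y0 :: "'b::real_normed_vector"
  assumes p: "1 \<le> p" and P: "small_patch (psum_norm p) e (x0, y0) F d"
    and larger: "norm y0 \<le> norm x0"
  shows "\<exists>(x1::'a) G c. small_patch norm (2 * e) x1 G c"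
proof -
  define r where "r = max (norm x0) (1/2)"
  have r: "1/2 \<le> r" "0 < r" "norm x0 \<le> r" by (auto simp: r_def)
  have centre: "norm x0 powr p + norm y0 powr p \<le> 1"
    using P by (simp add: small_patch_def psum_norm_le_one_iff[OF p])
  have room: "r powr p + norm y0 powr p \<le> 1"
  proof (cases "1/2 \<le> norm x0")
    case True
    then have "r = norm x0" by (simp add: r_def)
    then show ?thesis using centre by simp
  next
    case False
    then have "norm y0 \<le> 1/2" "r = 1/2" using larger by (auto simp: r_def)
    \<comment> \<open>The bound in terms of the larger coordinate, with the real number \<open>r\<close> as a vector of norm \<open>r\<close>,
      is \<open>(1/2)\<^sup>p + (1/2)\<^sup>p \<le> 1\<close>.\<close>
    then have "psum_norm p (r, y0) \<le> 1"
      using psum_norm_le_twice[OF p, of "(r, y0)" "1/2"] by simp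
    then show ?thesis using r by (simp add: psum_norm_le_one_iff[OF p])
  qed
  \<comment> \<open>Stretching by \<open>1/r\<close> also stretches the tolerance, which becomes \<open>d / r\<close> below.\<close>
  define x1 where "x1 = x0 /\<^sub>R r"
  define G where "G = (\<lambda>f x. f (x, 0 :: 'b)) ` F"
  have lin: "linear f" if "f \<in> F" for f
    using P that by (auto simp: small_patch_def norm_dual_def)
  have "G \<subseteq> norm_dual norm"
  proof -
    have "(\<lambda>x. f (x, 0 :: 'b)) \<in> norm_dual norm" if f: "f \<in> F" for f
    proof -
      obtain K where K: "\<And>z. \<bar>f z\<bar> \<le> K * psum_norm p z"
        using P f unfolding small_patch_def norm_dual_def by blast
      have "linear (\<lambda>x::'a. (x, 0 :: 'b))" by (rule linearI) auto
      from linear_compose[OF this lin[OF f]] have "linear (\<lambda>x. f (x, 0))"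
        by (simp add: o_def)
      moreover have "\<bar>f (x, 0)\<bar> \<le> K * norm x" for x
        using K[of "(x, 0)"] by (simp add: psum_norm_first[OF p])
      ultimately show ?thesis by (auto simp: norm_dual_def)
    qed
    then show ?thesis by (auto simp: G_def)
  qed
  have scaled: "(r *\<^sub>R x, y0) \<in> patch (psum_norm p) (x0, y0) F d"
    if x: "x \<in> patch norm x1 G (d / r)" for x
  proof -
    have "norm (r *\<^sub>R x) \<le> r" using x r by (simp add: patch_def mult_left_le)
    then have "norm (r *\<^sub>R x) powr p \<le> r powr p" using p by (intro powr_mono2) auto
    then have "psum_norm p (r *\<^sub>R x, y0) \<le> 1"
      using room by (simp add: psum_norm_le_one_iff[OF p])
    moreover have "\<bar>f (r *\<^sub>R x, y0) - f (x0, y0)\<bar> < d" if f: "f \<in> F" for f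
    proof -
      have "f (r *\<^sub>R x, y0) - f (x0, y0) = f (r *\<^sub>R ((x, 0) - (x1, 0)))"
        using r by (simp add: linear_diff[OF lin[OF f], symmetric] x1_def scaleR_diff_right)
      also have "\<dots> = r * (f (x, 0) - f (x1, 0))"
        by (simp only: linear_scale[OF lin[OF f]] linear_diff[OF lin[OF f]] real_scaleR_def)
      finally have "\<bar>f (r *\<^sub>R x, y0) - f (x0, y0)\<bar> = r * \<bar>f (x, 0) - f (x1, 0)\<bar>"
        using r by (simp add: abs_mult)
      also have "\<dots> < d"
        using x f r by (auto simp: patch_def G_def field_simps)
      finally show ?thesis .
    qed
    ultimately show ?thesis by (simp add: patch_def)
  qed
  have "norm (x - y) \<le> 2 * e" if "x \<in> patch norm x1 G (d / r)" "y \<in> patch norm x1 G (d / r)" for x y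
  proof -
    have "psum_norm p ((r *\<^sub>R x, y0) - (r *\<^sub>R y, y0)) \<le> e"
      using P scaled[OF that(1)] scaled[OF that(2)] unfolding small_patch_def by blast
    then have "norm (r *\<^sub>R (x - y)) \<le> e"
      by (simp add: psum_norm_first[OF p] scaleR_diff_right)
    then have "r * norm (x - y) \<le> e" using r by simp
    moreover have "1/2 * norm (x - y) \<le> r * norm (x - y)"
      using r by (intro mult_right_mono) auto
    ultimately show ?thesis by simp
  qed
  moreover have "norm x1 \<le> 1" using r by (simp add: x1_def field_simps)
  ultimately have "small_patch norm (2 * e) x1 G (d / r)"
    using P r \<open>G \<subseteq> norm_dual norm\<close> by (simp add: small_patch_def G_def)
  then show ?thesis by blast
qed

lemma BHP_psum_imp_BHP_summand:
  assumes p: "1 \<le> p"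
    and Z: "BHP (psum_norm p :: 'a::real_normed_vector \<times> 'b::real_normed_vector \<Rightarrow> real)"
  shows "BHP (norm :: 'a \<Rightarrow> real) \<or> BHP (norm :: 'b \<Rightarrow> real)"
proof (rule ccontr)
  assume "\<not> ?thesis"
  then obtain a b where a: "0 < a" "\<nexists>(x::'a) F d. small_patch norm a x F d"
    and b: "0 < b" "\<nexists>(y::'b) F d. small_patch norm b y F d"
    unfolding BHP_norm_iff by blast
  define e where "e = min a b / 2"
  have e: "0 < e" "2 * e \<le> a" "2 * e \<le> b" using a(1) b(1) by (auto simp: e_def)
  obtain x0 :: 'a and y0 :: 'b and F d where P: "small_patch (psum_norm p) e (x0, y0) F d"
    using Z e(1) unfolding BHP_psum_norm_iff[OF p] by (metis surj_pair)
  show False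
  proof (cases "norm y0 \<le> norm x0")
    case True
    then show False
      using small_patch_of_sum_imp_first[OF p P] small_patch_mono e(2) a(2) by blast
  next
    case False
    then show False
      using small_patch_of_sum_imp_first[OF p small_patch_psum_swap[OF P, simplified]]
        small_patch_mono e(3) b(2) by (metis linear)
  qed
qed

theorem proposition2p8:
  fixes p :: real
  assumes "\<exists>x::'a::banach. x \<noteq> 0"
    and "\<exists>y::'b::banach. y \<noteq> 0"
    and "1 \<le> p"
  shows "BHP (psum_norm p :: 'a \<times> 'b \<Rightarrow> real)
    \<longleftrightarrow> BHP (norm :: 'a \<Rightarrow> real) \<or> BHP (norm :: 'b \<Rightarrow> real)"
  using BHP_psum_imp_BHP_summand[OF assms(3)] BHP_first_imp_BHP_psum[OF assms(1,3)]
    BHP_psum_swap[OF assms(3) BHP_first_imp_BHP_psum[OF assms(2,3)]]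
  by blast

end
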